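(* Let $B$ be a complete ccc Boolean algebra. $B$ does not add independent reals if and only if the topological space $(B, \tau_s)$ is sequentially compact.
   Context: A Boolean algebra is ccc if every antichain (set of pairwise disjoint nonzero elements) is countable. $B$ adds an independent real if in a generic extension $V[G]$ of the universe $V$ by $B$ there exists $X \subset \omega$ such that neither $X$ nor $\omega - X$ has an infinite subset $Y$ with $Y \in V$. $B$ does not add independent reals if no generic extension by $B$ contains such an $X$. Algebraic convergence in a complete Boolean algebra $B$: a sequence $\langle a_n : n\in\omega\rangle$ converges to $\mathbf{0}$ if there is a decreasing sequence $b_0 \ge b_1 \ge \dots$ with $\bigwedge_n b_n = \mathbf{0}$ and $a_n \le b_n$ for all $n$; it converges to $a \in B$ if the sequence of symmetric differences $\langle a_n \vartriangle a : n \in \omega\rangle$ converges to $\mathbf{0}$. The order sequential topology $\tau_s$ on $B$ is defined by: the closure of $A \subset B$ is the smallest set $\overline{A} \supset A$ such that the limit of every (algebraically) convergent sequence of elements of $\overline{A}$ belongs to $\overline{A}$. A topological space is sequentially compact if every sequence in it has a (topologically) convergent subsequence. *)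

theory Defs
  imports "HOL-Analysis.Analysis"
begin

text \<open>
  A complete Boolean algebra is a type of sort \<open>{boolean_algebra, complete_lattice}\<close>. The library
  class \<open>complete_boolean_algebra\<close> is not used: it includes complete distributivity, which
  forces the algebra to be atomic.
\<close>

definition ccc :: "'b::{boolean_algebra, complete_lattice} itself \<Rightarrow> bool" where
  "ccc _ \<longleftrightarrow>
     (\<forall>A::'b set. bot \<notin> A \<longrightarrow> pairwise (\<lambda>a b. inf a b = bot) A \<longrightarrow> countable A)"


section \<open>The order sequential topology\<close>

definition ba_sym_diff :: "'b::boolean_algebra \<Rightarrow> 'b \<Rightarrow> 'b" where
  "ba_sym_diff a b = sup (a - b) (b - a)"

definition alg_null :: "(nat \<Rightarrow> 'b::{boolean_algebra, complete_lattice}) \<Rightarrow> bool" where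
  "alg_null a \<longleftrightarrow> (\<exists>b. decseq b \<and> (INF n. b n) = bot \<and> (\<forall>n. a n \<le> b n))"

definition alg_converges ::
    "(nat \<Rightarrow> 'b::{boolean_algebra, complete_lattice}) \<Rightarrow> 'b \<Rightarrow> bool" where
  "alg_converges a l \<longleftrightarrow> alg_null (\<lambda>n. ba_sym_diff (a n) l)"

definition alg_seq_closed :: "'b::{boolean_algebra, complete_lattice} set \<Rightarrow> bool" where
  "alg_seq_closed C \<longleftrightarrow> (\<forall>a l. range a \<subseteq> C \<longrightarrow> alg_converges a l \<longrightarrow> l \<in> C)"

definition order_seq_closure :: "'b::{boolean_algebra, complete_lattice} set \<Rightarrow> 'b set" where
  "order_seq_closure A = \<Inter>{C. A \<subseteq> C \<and> alg_seq_closed C}"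

text \<open>That this is a topology with closure operator \<^const>\<open>order_seq_closure\<close> is proved below.\<close>

definition order_seq_topology :: "'b::{boolean_algebra, complete_lattice} topology" where
  "order_seq_topology = topology (\<lambda>U. order_seq_closure (- U) = - U)"

definition seq_compact_space :: "'a topology \<Rightarrow> bool" where
  "seq_compact_space T \<longleftrightarrow>
     (\<forall>x. range x \<subseteq> topspace T \<longrightarrow>
        (\<exists>l r. strict_mono (r :: nat \<Rightarrow> nat) \<and> limitin T (x \<circ> r) l sequentially))"

lemma alg_seq_closedD:
  assumes "alg_seq_closed C" "\<And>n. a n \<in> C" "alg_converges a l"
  shows "l \<in> C"
  using assms(1)[unfolded alg_seq_closed_def, rule_format, of a l] assms(2,3)
  by (simp add: image_subset_iff)

lemma order_seq_closure_subset: "A \<subseteq> order_seq_closure A"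
  unfolding order_seq_closure_def by (rule Inter_greatest) simp

lemma order_seq_closure_least:
  assumes "A \<subseteq> C" "alg_seq_closed C"
  shows "order_seq_closure A \<subseteq> C"
  unfolding order_seq_closure_def by (rule Inter_lower) (simp add: assms)

lemma alg_seq_closed_Inter:
  assumes "\<And>C. C \<in> K \<Longrightarrow> alg_seq_closed C"
  shows "alg_seq_closed (\<Inter>K)"
  unfolding alg_seq_closed_def
proof (intro allI impI InterI)
  fix a l C
  assume *: "range a \<subseteq> \<Inter>K" "alg_converges a l" "C \<in> K"
  have "a n \<in> C" for n
    using *(1,3) by (metis InterE rangeI subsetD)
  then show "l \<in> C"
    by (rule alg_seq_closedD[OF assms[OF *(3)] _ *(2)])
qed

lemma alg_seq_closed_closure: "alg_seq_closed (order_seq_closure A)"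
  unfolding order_seq_closure_def by (rule alg_seq_closed_Inter) simp

lemma order_seq_closure_fixed_iff: "order_seq_closure A = A \<longleftrightarrow> alg_seq_closed A"
  by (metis alg_seq_closed_closure order_seq_closure_least order_seq_closure_subset
      subset_antisym subset_refl)

lemma alg_converges_subseq:
  assumes "alg_converges a l" "strict_mono (r :: nat \<Rightarrow> nat)"
  shows "alg_converges (\<lambda>n. a (r n)) l"
proof -
  obtain b where b: "decseq b" "(INF n. b n) = bot" "\<forall>n. ba_sym_diff (a n) l \<le> b n"
    using assms(1) unfolding alg_converges_def alg_null_def by (elim exE conjE)
  have "ba_sym_diff (a (r n)) l \<le> b n" for n
    using spec[OF b(3)] decseqD[OF b(1) seq_suble[OF assms(2), of n]] by (rule order_trans)
  then show ?thesis
    unfolding alg_converges_def alg_null_def using b(1,2) by (intro exI[of _ b] conjI allI)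
qed

lemma alg_seq_closed_Un:
  assumes "alg_seq_closed C" "alg_seq_closed D"
  shows "alg_seq_closed (C \<union> D)"
  unfolding alg_seq_closed_def
proof (intro allI impI)
  fix a l
  assume a: "range a \<subseteq> C \<union> D" "alg_converges a l"
  have *: "l \<in> E" if E: "alg_seq_closed E" "infinite {n. a n \<in> E}" for E
  proof (rule alg_seq_closedD[OF E(1)])
    show "a (enumerate {n. a n \<in> E} n) \<in> E" for n
      using enumerate_in_set[OF E(2), of n] by simp
    show "alg_converges (\<lambda>n. a (enumerate {n. a n \<in> E} n)) l"
      by (rule alg_converges_subseq[OF a(2) strict_mono_enumerate[OF E(2)]])
  qed
  have "{n. a n \<in> C} \<union> {n. a n \<in> D} = UNIV"
    using a(1) by auto
  then have "infinite {n. a n \<in> C} \<or> infinite {n. a n \<in> D}"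
    using infinite_UNIV_nat finite_Un by metis
  then show "l \<in> C \<union> D"
    using *[OF assms(1)] *[OF assms(2)] by (elim disjE) simp_all
qed

lemma istopology_order_seq: "istopology (\<lambda>U. order_seq_closure (- U) = - U)"
  unfolding istopology_def order_seq_closure_fixed_iff
proof (intro conjI allI impI)
  fix S T :: "'a set"
  assume "alg_seq_closed (- S)" "alg_seq_closed (- T)"
  then show "alg_seq_closed (- (S \<inter> T))"
    unfolding Compl_Int by (rule alg_seq_closed_Un)
next
  fix K :: "'a set set"
  assume K: "\<forall>U\<in>K. alg_seq_closed (- U)"
  have "alg_seq_closed (\<Inter>(uminus ` K))"
    using K by (intro alg_seq_closed_Inter) (elim imageE, simp)
  then show "alg_seq_closed (- \<Union>K)"
    by (simp only: uminus_Sup)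
qed

lemma openin_order_seq: "openin order_seq_topology U \<longleftrightarrow> alg_seq_closed (- U)"
  unfolding order_seq_topology_def topology_inverse'[OF istopology_order_seq]
  by (rule order_seq_closure_fixed_iff)

lemma topspace_order_seq [simp]: "topspace order_seq_topology = UNIV"
proof -
  have "openin order_seq_topology UNIV"
    by (simp add: openin_order_seq alg_seq_closed_def)
  then have "UNIV \<subseteq> topspace (order_seq_topology :: 'a topology)"
    by (rule openin_subset)
  then show ?thesis
    by (rule top.extremum_uniqueI)
qed

lemma closure_of_order_seq: "order_seq_topology closure_of A = order_seq_closure A"
proof -
  have "closedin order_seq_topology C \<longleftrightarrow> alg_seq_closed C" for C :: "'a set"
    unfolding closedin_def topspace_order_seq openin_order_seq by (simp add: Diff_eq)
  then show ?thesis
    by (simp add: order_seq_closure_def closure_of_hull hull_def conj_commute)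
qed


section \<open>Independent reals\<close>

text \<open>
  Generic extensions are handled through the Boolean-valued universe: a sentence holds in some
  generic extension by \<open>B\<close> iff its Boolean value is not \<open>\<zero>\<close>. HOL is the ground model.
  Names are well-founded trees \<open>{(t i, b i) | i}\<close>, meaning that \<open>t i\<close> is an element with
  truth value \<open>b i\<close>. HOL has no proper class of names, so the cardinality of a family is
  bounded by that of the index type \<open>nat \<times> 'i\<close>; as \<open>'i\<close> is an arbitrary type, the bound
  is an arbitrary infinite cardinal, and any family of names of subsets of \<open>\<omega>\<close> is covered.
\<close>

datatype ('i, 'b) name =
    Empty
  | Name "nat \<times> 'i \<Rightarrow> ('i, 'b) name" "nat \<times> 'i \<Rightarrow> 'b"

text \<open>The values of the bounded quantifications \<open>\<exists>u\<in>y. P u\<close> and \<open>\<forall>u\<in>y. P u\<close>:\<close>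

definition bv_bex ::
    "('i, 'b::{boolean_algebra, complete_lattice}) name \<Rightarrow> (('i, 'b) name \<Rightarrow> 'b) \<Rightarrow> 'b" where
  "bv_bex y P = (case y of Empty \<Rightarrow> bot | Name s c \<Rightarrow> (SUP j. inf (c j) (P (s j))))"

definition bv_ball ::
    "('i, 'b::{boolean_algebra, complete_lattice}) name \<Rightarrow> (('i, 'b) name \<Rightarrow> 'b) \<Rightarrow> 'b" where
  "bv_ball y P = (case y of Empty \<Rightarrow> top | Name s c \<Rightarrow> (INF j. sup (- c j) (P (s j))))"

text \<open>Extensional equality, by recursion on the first argument; see \<open>bv_eq_subset\<close> below.\<close>

primrec bv_eq ::
    "('i, 'b::{boolean_algebra, complete_lattice}) name \<Rightarrow> ('i, 'b) name \<Rightarrow> 'b" where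
  "bv_eq Empty y = bv_ball y (\<lambda>v. bot)"
| "bv_eq (Name t b) y =
     inf (INF i. sup (- b i) (bv_bex y (bv_eq (t i))))
         (bv_ball y (\<lambda>v. SUP i. inf (b i) (bv_eq (t i) v)))"

definition bv_mem ::
    "('i, 'b::{boolean_algebra, complete_lattice}) name \<Rightarrow> ('i, 'b) name \<Rightarrow> 'b" where
  "bv_mem x y = bv_bex y (\<lambda>v. bv_eq x v)"

definition bv_subset ::
    "('i, 'b::{boolean_algebra, complete_lattice}) name \<Rightarrow> ('i, 'b) name \<Rightarrow> 'b" where
  "bv_subset x y = bv_ball x (\<lambda>u. bv_mem u y)"

lemma bv_eq_sym: "bv_eq x y = bv_eq y x"
proof (induction x arbitrary: y)
  case Empty
  then show ?case
    by (cases y) (simp_all add: bv_ball_def bv_bex_def)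
next
  case (Name t b)
  have *: "bv_eq v (t i) = bv_eq (t i) v" for i v
    using Name.IH[of "t i" v] by simp
  show ?case
  proof (cases y)
    case Empty
    then show ?thesis
      by (simp add: bv_ball_def bv_bex_def)
  next
    case y: (Name s c)
    show ?thesis
      unfolding y bv_eq.simps bv_ball_def bv_bex_def name.case * by (rule inf.commute)
  qed
qed

lemma bv_eq_subset: "bv_eq x y = inf (bv_subset x y) (bv_subset y x)"
proof (cases x)
  case Empty
  then show ?thesis
    by (simp add: bv_subset_def bv_mem_def bv_ball_def bv_bex_def)
next
  case (Name t b)
  have "bv_eq v (t i) = bv_eq (t i) v" for i v
    by (rule bv_eq_sym)
  then show ?thesis
    unfolding Name bv_subset_def bv_mem_def bv_eq.simps by (simp add: bv_ball_def bv_bex_def)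
qed

text \<open>The name of \<open>x - y\<close>:\<close>

definition name_diff ::
    "('i, 'b::{boolean_algebra, complete_lattice}) name \<Rightarrow> ('i, 'b) name \<Rightarrow> ('i, 'b) name" where
  "name_diff x y =
     (case x of Empty \<Rightarrow> Empty | Name t b \<Rightarrow> Name t (\<lambda>i. inf (b i) (- bv_mem (t i) y)))"

text \<open>Canonical names of ground model objects: von Neumann numerals and subsets of \<open>\<omega>\<close>.\<close>

fun check_nat :: "nat \<Rightarrow> ('i, 'b::{boolean_algebra, complete_lattice}) name" where
  "check_nat n =
     Name (\<lambda>p. if fst p < n then check_nat (fst p) else Empty)
          (\<lambda>p. if fst p < n then top else bot)"

declare check_nat.simps [simp del]

definition check_set :: "nat set \<Rightarrow> ('i, 'b::{boolean_algebra, complete_lattice}) name" where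
  "check_set Y = Name (\<lambda>p. check_nat (fst p)) (\<lambda>p. if fst p \<in> Y then top else bot)"

abbreviation name_omega :: "('i, 'b::{boolean_algebra, complete_lattice}) name" where
  "name_omega \<equiv> check_set UNIV"

lemma bv_bex_check_nat:
  fixes P :: "('i, 'b::{boolean_algebra, complete_lattice}) name \<Rightarrow> 'b"
  shows "bv_bex (check_nat n) P = (SUP k\<in>{..<n}. P (check_nat k))"
proof -
  have "bv_bex (check_nat n) P =
          (SUP p::nat \<times> 'i. inf (if fst p < n then top else bot)
                      (P (if fst p < n then check_nat (fst p) else Empty)))"
    by (subst check_nat.simps) (simp only: bv_bex_def name.case)
  also have "\<dots> = (SUP k\<in>{..<n}. P (check_nat k))"
    by (intro order.antisym SUP_least) (auto intro: SUP_upper SUP_upper2[of "(_, undefined)"])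
  finally show ?thesis .
qed

lemma bv_ball_check_nat:
  fixes P :: "('i, 'b::{boolean_algebra, complete_lattice}) name \<Rightarrow> 'b"
  shows "bv_ball (check_nat n) P = (INF k\<in>{..<n}. P (check_nat k))"
proof -
  have "bv_ball (check_nat n) P =
          (INF p::nat \<times> 'i. sup (- (if fst p < n then top else bot))
                      (P (if fst p < n then check_nat (fst p) else Empty)))"
    by (subst check_nat.simps) (simp only: bv_ball_def name.case)
  also have "\<dots> = (INF k\<in>{..<n}. P (check_nat k))"
    by (intro order.antisym INF_greatest) (auto intro: INF_lower INF_lower2[of "(_, undefined)"])
  finally show ?thesis .
qed

lemma bv_eq_check_nat:
  "bv_eq (check_nat m :: ('i, 'b::{boolean_algebra, complete_lattice}) name) (check_nat n) = (if m = n then top else bot)"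
proof (induction m arbitrary: n rule: less_induct)
  case (less m)
  have 1: "bv_subset (check_nat m :: ('i, 'b) name) (check_nat n) =
             (INF i\<in>{..<m}. SUP j\<in>{..<n}. if i = j then top else bot)"
    unfolding bv_subset_def bv_mem_def bv_ball_check_nat bv_bex_check_nat
    by (intro INF_cong SUP_cong refl) (simp only: less.IH lessThan_iff)
  have 2: "bv_subset (check_nat n :: ('i, 'b) name) (check_nat m) =
             (INF j\<in>{..<n}. SUP i\<in>{..<m}. if i = j then top else bot)"
    unfolding bv_subset_def bv_mem_def bv_ball_check_nat bv_bex_check_nat
    by (intro INF_cong SUP_cong refl, subst bv_eq_sym) (simp only: less.IH lessThan_iff)
  have top: "(INF i\<in>A. SUP j\<in>B. if P i j then top else bot) = (top::'b)"
    if ex: "\<And>i. i \<in> A \<Longrightarrow> \<exists>j\<in>B. P i j" for A B :: "nat set" and P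
    unfolding top_unique[symmetric]
  proof (rule INF_greatest)
    fix i assume "i \<in> A"
    then obtain j where "j \<in> B" "P i j" using ex by blast
    then show "top \<le> (SUP j\<in>B. if P i j then top else (bot::'b))"
      by (intro SUP_upper2[of j]) simp_all
  qed
  have bot: "(INF i\<in>A. SUP j\<in>B. if P i j then top else bot) = (bot::'b)"
    if "i \<in> A" "\<And>j. j \<in> B \<Longrightarrow> \<not> P i j" for A B :: "nat set" and P i
    unfolding bot_unique[symmetric]
    by (rule INF_lower2[OF that(1)], rule SUP_least) (simp add: that(2))
  consider "m = n" | "m < n" | "n < m"
    by linarith
  then show ?case
  proof cases
    case a: 1
    have "bv_subset (check_nat m :: ('i, 'b) name) (check_nat n) = (top::'b)"
      unfolding 1 by (rule top) (simp add: a)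
    then show ?thesis
      unfolding bv_eq_subset using a by simp
  next
    case a: 2
    have "bv_subset (check_nat n :: ('i, 'b) name) (check_nat m) = (bot::'b)"
      unfolding 2 by (rule bot[of m]) (use a in auto)
    then show ?thesis
      unfolding bv_eq_subset using a by simp
  next
    case a: 3
    have "bv_subset (check_nat m :: ('i, 'b) name) (check_nat n) = (bot::'b)"
      unfolding 1 by (rule bot[of n]) (use a in auto)
    then show ?thesis
      unfolding bv_eq_subset using a by simp
  qed
qed

lemma bv_subset_check_set:
  fixes X :: "('i, 'b::{boolean_algebra, complete_lattice}) name"
  shows "bv_subset (check_set Y) X = (INF n\<in>Y. bv_mem (check_nat n) X)"
proof -
  have "bv_subset (check_set Y) X =
          (INF p::nat \<times> 'i. sup (- (if fst p \<in> Y then top else bot)) (bv_mem (check_nat (fst p)) X))"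
    by (simp only: bv_subset_def check_set_def bv_ball_def name.case)
  also have "\<dots> = (INF n\<in>Y. bv_mem (check_nat n) X)"
    by (intro order.antisym INF_greatest) (auto intro: INF_lower INF_lower2[of "(_, undefined)"])
  finally show ?thesis .
qed

text \<open>A nice name: every sequence of elements of \<open>B\<close> is the sequence of values \<open>n \<in> X\<close> for some \<open>X\<close>.\<close>

lemma bv_mem_nice_name:
  "bv_mem (check_nat n) (Name (\<lambda>p. check_nat (fst p)) (\<lambda>p. f (fst p))) = f n"
  unfolding bv_mem_def bv_bex_def name.case bv_eq_check_nat
  by (intro order.antisym SUP_least) (auto intro: SUP_upper2[of "(n, undefined)"])

lemma bv_mem_omega_diff:
  "bv_mem (check_nat n) (name_diff name_omega X) = - bv_mem (check_nat n) X"
proof -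
  have "name_diff name_omega X =
          Name (\<lambda>p. check_nat (fst p)) (\<lambda>p. - bv_mem (check_nat (fst p)) X)"
    by (simp add: name_diff_def check_set_def)
  then show ?thesis
    by (simp only: bv_mem_nice_name[of n "\<lambda>k. - bv_mem (check_nat k) X"])
qed

text \<open>
  The value of ``\<open>X \<subseteq> \<omega>\<close>, and there is no infinite \<open>Y \<subseteq> \<omega>\<close> in the ground model with
  \<open>Y \<subseteq> X\<close> or \<open>Y \<subseteq> \<omega> - X\<close>''.
\<close>

definition bv_independent :: "('i, 'b::{boolean_algebra, complete_lattice}) name \<Rightarrow> 'b" where
  "bv_independent X =
     inf (bv_subset X name_omega)
         (- (SUP Y\<in>{Y. infinite Y}.
               sup (bv_subset (check_set Y) X)
                   (bv_subset (check_set Y) (name_diff name_omega X))))"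

definition adds_independent_real ::
    "'i itself \<Rightarrow> 'b::{boolean_algebra, complete_lattice} itself \<Rightarrow> bool" where
  "adds_independent_real _ _ \<longleftrightarrow> (SUP X::('i, 'b) name. bv_independent X) \<noteq> bot"

end

theory Submission
  imports Defs
begin

text \<open>
  Topological convergence has to be related to algebraic convergence although \<open>\<tau>\<^sub>s\<close> need not be
  Hausdorff: if no subsequence of \<open>x\<close> converges algebraically, then every tail of \<open>x\<close> has a
  sequentially closed range, so no subsequence of \<open>x\<close> converges topologically either. Hence
  sequential compactness says that every sequence has an algebraically convergent subsequence.

  A real corresponds to a sequence \<open>a\<close> in \<open>B\<close>, and no condition forces it to be independent iff
  the elements that decide \<open>a\<close> to be constantly true or constantly false along some infinite set
  in the ground model are dense. A sequence converges algebraically along \<open>Z\<close> iff the elements that decide it on a tail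
  of \<open>Z\<close> itself are dense. Passing from the former to the latter is an exhaustion argument:
  shrink \<open>Z\<close> modulo finite sets so that the join of these elements strictly grows. By ccc only
  countably many steps matter, so limit stages have pseudo-intersections, and Zorn's lemma
  yields a \<open>Z\<close> where the join is \<open>\<one>\<close>.
\<close>

section \<open>Complete Boolean algebras\<close>

lemma compl_SUP:
  fixes f :: "'a \<Rightarrow> 'b::{boolean_algebra, complete_lattice}"
  shows "- (SUP i\<in>I. f i) = (INF i\<in>I. - f i)"
proof (rule order.antisym)
  show "- (SUP i\<in>I. f i) \<le> (INF i\<in>I. - f i)"
    by (rule INF_greatest) (simp add: SUP_upper)
  have "(SUP i\<in>I. f i) \<le> - (INF i\<in>I. - f i)"
    by (rule SUP_least) (metis INF_lower compl_le_swap1)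
  then show "(INF i\<in>I. - f i) \<le> - (SUP i\<in>I. f i)"
    by (rule compl_le_swap1)
qed

lemma compl_INF:
  fixes f :: "'a \<Rightarrow> 'b::{boolean_algebra, complete_lattice}"
  shows "- (INF i\<in>I. f i) = (SUP i\<in>I. - f i)"
proof -
  have "- (SUP i\<in>I. - f i) = (INF i\<in>I. f i)"
    by (simp add: compl_SUP)
  then show ?thesis
    by (metis double_compl)
qed

text \<open>A maximal antichain of elements lying below members of \<open>D\<close> is countable;
  choosing a member of \<open>D\<close> above each of its elements gives \<open>E\<close>. A member
  of \<open>D\<close> not below \<open>Sup E\<close> would contribute a new element to the
  antichain.\<close>

lemma ccc_countable_Sup:
  fixes D :: "'b::{boolean_algebra, complete_lattice} set"
  assumes "ccc TYPE('b)"
  obtains E where "countable E" "E \<subseteq> D" "Sup E = Sup D"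
proof -
  define AC where "AC = {A. bot \<notin> A \<and> pairwise (\<lambda>a b. inf a b = (bot::'b)) A \<and>
    (\<forall>a\<in>A. \<exists>d\<in>D. a \<le> d)}"
  have "\<exists>M\<in>AC. \<forall>X\<in>AC. M \<subseteq> X \<longrightarrow> X = M"
  proof (rule subset_Zorn')
    fix C assume C: "subset.chain AC C"
    have "pairwise (\<lambda>a b. inf a b = bot) (\<Union>C)"
      unfolding pairwise_def
    proof (intro ballI impI)
      fix a b assume ab: "a \<in> \<Union>C" "b \<in> \<Union>C" "a \<noteq> b"
      then obtain X Y where XY: "X \<in> C" "Y \<in> C" "a \<in> X" "b \<in> Y" by blast
      then have "X \<subseteq> Y \<or> Y \<subseteq> X"
        using C by (meson subset.chain_total subset_chain_def)
      then obtain W where "W \<in> C" "a \<in> W" "b \<in> W"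
        using XY by blast
      then show "inf a b = bot"
        using C ab(3) unfolding subset_chain_def AC_def pairwise_def by blast
    qed
    then show "\<Union>C \<in> AC"
      using C unfolding subset_chain_def AC_def by blast
  qed
  then obtain A where A: "A \<in> AC" and max: "\<And>X. X \<in> AC \<Longrightarrow> A \<subseteq> X \<Longrightarrow> X = A"
    by blast
  have "countable A"
    using A assms unfolding ccc_def AC_def by blast
  from A have "\<forall>a\<in>A. \<exists>d\<in>D. a \<le> d"
    unfolding AC_def by blast
  then obtain g where g: "\<And>a. a \<in> A \<Longrightarrow> g a \<in> D" "\<And>a. a \<in> A \<Longrightarrow> a \<le> g a"
    by metis
  have "d \<le> Sup (g ` A)" if d: "d \<in> D" for d
  proof (rule ccontr)
    define e where "e = inf d (- Sup (g ` A))"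
    assume "\<not> d \<le> Sup (g ` A)"
    then have e: "e \<noteq> bot"
      unfolding e_def by (simp add: inf_shunt)
    have disj: "inf e a = bot" if "a \<in> A" for a
    proof -
      have "a \<le> Sup (g ` A)"
        using g(2)[OF that] that by (meson SUP_upper2)
      then have "inf e a \<le> inf (- Sup (g ` A)) (Sup (g ` A))"
        unfolding e_def by (intro inf_mono) simp_all
      then show ?thesis
        by (simp add: bot_unique)
    qed
    have "\<forall>a\<in>insert e A. \<exists>d\<in>D. a \<le> d"
      using A d unfolding AC_def e_def by (auto intro: le_infI1)
    moreover have "pairwise (\<lambda>a b. inf a b = bot) (insert e A)"
      using A disj unfolding AC_def pairwise_insert by (simp add: inf_commute)
    ultimately have "insert e A \<in> AC"
      using A e unfolding AC_def by simp
    \<comment> \<open>By maximality \<open>e\<close> already lies in \<open>A\<close>, so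
      \<open>disj\<close> makes it disjoint from itself.\<close>
    then have "e \<in> A"
      using max by blast
    then show False
      using disj e by fastforce
  qed
  moreover have "g ` A \<subseteq> D"
    using g(1) by blast
  ultimately have "Sup (g ` A) = Sup D"
    by (intro order.antisym Sup_least Sup_subset_mono)
  then show ?thesis
    using that \<open>countable A\<close> \<open>g ` A \<subseteq> D\<close> by blast
qed


section \<open>Algebraic and topological convergence\<close>

text \<open>Read from the complement: below \<open>- z\<close>, the elements \<open>x\<close> and
  \<open>y\<close> coincide. This turns error bounds into decided values.\<close>

lemma ba_sym_diff_le_iff:
  fixes x y z :: "'b::boolean_algebra"
  shows "ba_sym_diff x y \<le> z \<longleftrightarrow> inf (- z) y \<le> x \<and> inf (- z) (- y) \<le> - x"
proof -
  have shunt: "inf u (- v) \<le> w \<longleftrightarrow> inf (- w) u \<le> v" for u v w :: 'b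
    by (simp add: shunt1 inf_commute[of "- w"] sup_commute[of v])
  have "inf x (- y) \<le> z \<longleftrightarrow> inf (- z) (- y) \<le> - x"
    using shunt[of "- y" "- x" z] by (simp add: inf_commute)
  then show ?thesis
    using shunt[of y x z] by (auto simp: ba_sym_diff_def diff_eq)
qed

lemma alg_converges_const_iff: "alg_converges (\<lambda>_. c) l \<longleftrightarrow> c = l"
proof
  assume "alg_converges (\<lambda>_. c) l"
  then obtain b where b: "(INF n. b n) = bot" "\<And>n::nat. ba_sym_diff c l \<le> b n"
    unfolding alg_converges_def alg_null_def by blast
  have "ba_sym_diff c l \<le> bot"
    unfolding b(1)[symmetric] by (rule INF_greatest) (rule b(2))
  then have "c - l = bot" "l - c = bot"
    by (simp_all add: ba_sym_diff_def bot_unique)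
  then show "c = l"
    by (simp add: diff_eq inf_shunt order.antisym)
next
  assume "c = l"
  then show "alg_converges (\<lambda>_. c) l"
    unfolding alg_converges_def alg_null_def ba_sym_diff_def
    by (intro exI[of _ "\<lambda>_. bot"]) (simp add: diff_eq decseq_def)
qed

text \<open>Infinitely many terms outside an open \<open>U\<close> would form a subsequence inside
  the closed complement with the same limit \<open>l\<close>.\<close>

lemma alg_converges_imp_limitin:
  assumes "alg_converges a l"
  shows "limitin order_seq_topology a l sequentially"
  unfolding limitin_def
proof (intro conjI allI impI)
  fix U assume U: "openin order_seq_topology U \<and> l \<in> U"
  show "\<forall>\<^sub>F n in sequentially. a n \<in> U"
  proof (rule ccontr)
    assume "\<not> (\<forall>\<^sub>F n in sequentially. a n \<in> U)"
    then have inf: "infinite {n. a n \<notin> U}"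
      by (simp add: cofinite_eq_sequentially[symmetric] eventually_cofinite)
    have "l \<in> - U"
    proof (rule alg_seq_closedD)
      show "alg_seq_closed (- U)"
        using U by (simp add: openin_order_seq)
      show "a (enumerate {n. a n \<notin> U} n) \<in> - U" for n
        using enumerate_in_set[OF inf, of n] by simp
      show "alg_converges (\<lambda>n. a (enumerate {n. a n \<notin> U} n)) l"
        by (rule alg_converges_subseq[OF assms strict_mono_enumerate[OF inf]])
    qed
    then show False
      using U by simp
  qed
qed simp

text \<open>A sequence drawn from the range of \<open>x\<close> has the form \<open>x (k n)\<close>
  with \<open>k\<close> not necessarily increasing. Along some indices it is either a true
  subsequence of \<open>x\<close> or one repeated term.\<close>

lemma strict_mono_subseq_or_constant:
  fixes k :: "nat \<Rightarrow> nat"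
  obtains s :: "nat \<Rightarrow> nat" where "strict_mono s" "strict_mono (k \<circ> s)"
    | s :: "nat \<Rightarrow> nat" and c where "strict_mono s" "\<And>n. k (s n) = c"
proof (cases "finite (range k)")
  case True
  then obtain c where c: "infinite (k -` {c})"
    using inf_img_fin_domE infinite_UNIV_nat by blast
  show ?thesis
    by (rule that(2)[OF strict_mono_enumerate[OF c]]) (use enumerate_in_set[OF c] in simp)
next
  case False
  have "\<exists>m>n. k m > v" for n v
  proof (rule ccontr)
    assume "\<not> ?thesis"
    then have "range k \<subseteq> k ` {..n} \<union> {..v}"
      by (force simp: not_less)
    then show False
      using False finite_subset by blast
  qed
  then have "\<exists>s. \<forall>n. True \<and> (s n < s (Suc n) \<and> k (s n) < k (s (Suc n)))"
    by (intro dependent_nat_choice) auto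
  then show ?thesis
    using that(1) by (auto simp: strict_mono_Suc_iff)
qed

lemma limitin_imp_alg_converges_subseq:
  fixes x :: "nat \<Rightarrow> 'b::{boolean_algebra, complete_lattice}"
  assumes lim: "limitin order_seq_topology x l sequentially"
  obtains s m where "strict_mono s" "alg_converges (x \<circ> s) m"
proof (rule ccontr)
  assume "\<not> thesis"
  with that have none: "\<not> alg_converges (x \<circ> s) m" if "strict_mono s" for s m
    using \<open>strict_mono s\<close> by blast
  have "\<forall>\<^sub>F n in sequentially. x n \<noteq> l"
  proof (rule ccontr)
    assume "\<not> ?thesis"
    then have inf: "infinite {n. x n = l}"
      by (simp add: cofinite_eq_sequentially[symmetric] eventually_cofinite)
    \<comment> \<open>Infinitely many occurrences of \<open>l\<close> would give a constant, hence
      convergent, subsequence.\<close>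
    have "x \<circ> enumerate {n. x n = l} = (\<lambda>_. l)"
      using enumerate_in_set[OF inf] by auto
    then show False
      using none[OF strict_mono_enumerate[OF inf], of l] by (simp add: alg_converges_const_iff)
  qed
  then obtain N where N: "\<And>n. n \<ge> N \<Longrightarrow> x n \<noteq> l"
    by (auto simp: eventually_sequentially)
  \<comment> \<open>By \<open>none\<close>, a convergent sequence in the tail cannot contain a
    subsequence of \<open>x\<close>; so it repeats one term infinitely often, and that term is its
    limit.\<close>
  have "alg_seq_closed (x ` {N..})"
    unfolding alg_seq_closed_def
  proof (intro allI impI)
    fix y m assume y: "range y \<subseteq> x ` {N..}" "alg_converges y m"
    then have "\<forall>n. \<exists>k\<ge>N. y n = x k"
      by blast
    then obtain k where k: "\<And>n. k n \<ge> N" "\<And>n. y n = x (k n)"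
      by metis
    show "m \<in> x ` {N..}"
    proof (rule strict_mono_subseq_or_constant[of k])
      fix s :: "nat \<Rightarrow> nat" assume s: "strict_mono s" "strict_mono (k \<circ> s)"
      show ?thesis
        using none[OF s(2), of m] alg_converges_subseq[OF y(2) s(1)] by (simp add: k(2) comp_def)
    next
      fix s :: "nat \<Rightarrow> nat" and c assume s: "strict_mono s" "\<And>n. k (s n) = c"
      have "x c = m"
        using alg_converges_subseq[OF y(2) s(1)] by (simp add: k(2) s(2) alg_converges_const_iff)
      then show ?thesis
        using k(1)[of "s 0"] s(2)[of 0] by auto
    qed
  qed
  then have "openin order_seq_topology (- x ` {N..})"
    by (simp add: openin_order_seq)
  moreover have "l \<in> - x ` {N..}"
    using N by auto
  ultimately have "\<forall>\<^sub>F n in sequentially. x n \<in> - x ` {N..}"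
    using lim unfolding limitin_def by blast
  then obtain M where "\<And>n. n \<ge> M \<Longrightarrow> x n \<notin> x ` {N..}"
    by (auto simp: eventually_sequentially)
  from this[of "max M N"] show False
    by simp
qed

lemma seq_compact_order_seq_iff:
  "seq_compact_space (order_seq_topology :: 'b::{boolean_algebra, complete_lattice} topology) \<longleftrightarrow>
     (\<forall>x::nat \<Rightarrow> 'b. \<exists>l r. strict_mono r \<and> alg_converges (x \<circ> r) l)"
proof (intro iffI allI impI)
  fix x :: "nat \<Rightarrow> 'b"
  assume "seq_compact_space (order_seq_topology :: 'b topology)"
  then obtain l r where r: "strict_mono r" "limitin order_seq_topology (x \<circ> r) l sequentially"
    unfolding seq_compact_space_def topspace_order_seq by blast
  obtain s m where s: "strict_mono s" "alg_converges (x \<circ> r \<circ> s) m"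
    by (rule limitin_imp_alg_converges_subseq[OF r(2)])
  then show "\<exists>l r. strict_mono r \<and> alg_converges (x \<circ> r) l"
    using strict_mono_o[OF r(1) s(1)] by (metis comp_assoc)
next
  assume "\<forall>x::nat \<Rightarrow> 'b. \<exists>l r. strict_mono r \<and> alg_converges (x \<circ> r) l"
  then show "seq_compact_space (order_seq_topology :: 'b topology)"
    unfolding seq_compact_space_def using alg_converges_imp_limitin by blast
qed


section \<open>Deciding a sequence along an infinite set\<close>

text \<open>The Boolean value of: \<open>Y\<close> is contained in the real with membership values
  \<open>a n\<close>, or in its complement.\<close>

definition decided_on :: "(nat \<Rightarrow> 'b::{boolean_algebra, complete_lattice}) \<Rightarrow> nat set \<Rightarrow> 'b" where
  "decided_on a Y = sup (INF n\<in>Y. a n) (INF n\<in>Y. - a n)"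

text \<open>The same with almost containment, modulo finite sets, in place of containment.\<close>

definition eventually_decided_on ::
    "(nat \<Rightarrow> 'b::{boolean_algebra, complete_lattice}) \<Rightarrow> nat set \<Rightarrow> 'b" where
  "eventually_decided_on a Y = (SUP m. decided_on a (Y \<inter> {m..}))"

text \<open>A name enters \<open>bv_independent\<close> only through its membership values and the
  value of its being a subset of omega. Nice names realize every sequence \<open>a\<close> and make
  the latter \<open>top\<close>, so the index type disappears.\<close>

lemma adds_independent_real_iff:
  "adds_independent_real TYPE('i) TYPE('b::{boolean_algebra, complete_lattice}) \<longleftrightarrow>
     (\<exists>a::nat \<Rightarrow> 'b. (SUP Y\<in>{Y. infinite Y}. decided_on a Y) \<noteq> top)"
proof -
  have indep: "bv_independent X = inf (bv_subset X name_omega)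
      (- (SUP Y\<in>{Y. infinite Y}. decided_on (\<lambda>n. bv_mem (check_nat n) X) Y))"
    for X :: "('i, 'b) name"
    unfolding bv_independent_def decided_on_def bv_subset_check_set bv_mem_omega_diff ..
  have nice: "bv_subset (Name (\<lambda>p. check_nat (fst p)) (\<lambda>p. a (fst p))) (name_omega :: ('i, 'b) name) = top"
    for a :: "nat \<Rightarrow> 'b"
  proof -
    have "bv_mem (check_nat n) (name_omega :: ('i, 'b) name) = top" for n
      using bv_mem_nice_name[of n "\<lambda>_. top"] by (simp add: check_set_def)
    then show ?thesis
      by (simp add: bv_subset_def bv_ball_def)
  qed
  have nice_value: "bv_independent (Name (\<lambda>p. check_nat (fst p)) (\<lambda>p. a (fst p)) :: ('i, 'b) name) =
      - (SUP Y\<in>{Y. infinite Y}. decided_on a Y)" for a :: "nat \<Rightarrow> 'b"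
    unfolding indep nice bv_mem_nice_name by simp
  show ?thesis
  proof
    assume "adds_independent_real TYPE('i) TYPE('b)"
    then obtain X :: "('i, 'b) name" where "bv_independent X \<noteq> bot"
      unfolding adds_independent_real_def by (metis SUP_bot_conv(2))
    then show "\<exists>a::nat \<Rightarrow> 'b. (SUP Y\<in>{Y. infinite Y}. decided_on a Y) \<noteq> top"
      unfolding indep by (metis compl_top_eq inf_bot_right)
  next
    assume "\<exists>a::nat \<Rightarrow> 'b. (SUP Y\<in>{Y. infinite Y}. decided_on a Y) \<noteq> top"
    then obtain a :: "nat \<Rightarrow> 'b" where "(SUP Y\<in>{Y. infinite Y}. decided_on a Y) \<noteq> top" ..
    then have "bv_independent (Name (\<lambda>p. check_nat (fst p)) (\<lambda>p. a (fst p)) :: ('i, 'b) name) \<noteq> bot"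
      unfolding nice_value by (metis compl_bot_eq double_compl)
    then show "adds_independent_real TYPE('i) TYPE('b)"
      unfolding adds_independent_real_def by (metis SUP_bot_conv(2) UNIV_I)
  qed
qed

section \<open>Monotonicity of decided elements\<close>

lemma decided_on_antimono: "Y \<subseteq> Z \<Longrightarrow> decided_on a Z \<le> decided_on a Y"
  unfolding decided_on_def by (intro sup_mono INF_superset_mono) auto

text \<open>Tails absorb finite differences, so shrinking a set modulo finite can only increase this
  element. The exhaustion relies on it.\<close>

lemma eventually_decided_on_mono:
  assumes "finite (Y - Z)"
  shows "eventually_decided_on a Z \<le> eventually_decided_on a Y"
  unfolding eventually_decided_on_def
proof (rule SUP_least)
  fix m
  obtain N where N: "Y - Z \<subseteq> {..<N}"
    using assms finite_nat_iff_bounded by blast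
  have "decided_on a (Z \<inter> {m..}) \<le> decided_on a (Y \<inter> {max m N..})"
    by (rule decided_on_antimono) (use N in auto)
  then show "decided_on a (Z \<inter> {m..}) \<le> (SUP m. decided_on a (Y \<inter> {m..}))"
    by (rule SUP_upper2[OF UNIV_I])
qed

lemma decided_on_le_eventually: "decided_on a Y \<le> eventually_decided_on a Y"
  unfolding eventually_decided_on_def by (rule SUP_upper2[of 0]) simp_all

lemma decided_on_image: "decided_on a (r ` Y) = decided_on (a \<circ> r) Y"
  by (simp add: decided_on_def image_comp)

section \<open>Algebraic convergence and decided elements\<close>

lemma SUP_decided_on_if_alg_converges:
  fixes a :: "nat \<Rightarrow> 'b::{boolean_algebra, complete_lattice}"
  assumes r: "strict_mono r" and lim: "alg_converges (a \<circ> r) l"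
  shows "(SUP Y\<in>{Y. infinite Y}. decided_on a Y) = top"
proof -
  obtain b where b: "decseq b" "(INF n. b n) = bot" "\<And>n. ba_sym_diff (a (r n)) l \<le> b n"
    using lim unfolding alg_converges_def alg_null_def by auto
  \<comment> \<open>Off the error bound \<open>b m\<close>, all terms from \<open>m\<close> on agree
    with \<open>l\<close>: below \<open>- b m\<close> the tail is constantly true on
    \<open>l\<close> and constantly false on \<open>- l\<close>.\<close>
  have "- b m \<le> (SUP Y\<in>{Y. infinite Y}. decided_on a Y)" for m
  proof (rule SUP_upper2)
    show "r ` {m..} \<in> {Y. infinite Y}"
      using r by (simp add: finite_image_iff infinite_Ici strict_mono_imp_inj_on inj_on_subset)
    have le: "ba_sym_diff (a (r n)) l \<le> b m" if "n \<ge> m" for n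
      using b(3) decseqD[OF b(1) that] by (rule order_trans)
    have "inf (- b m) l \<le> (INF n\<in>{m..}. a (r n))"
      using le by (intro INF_greatest) (simp add: ba_sym_diff_le_iff)
    moreover have "inf (- b m) (- l) \<le> (INF n\<in>{m..}. - a (r n))"
      using le by (intro INF_greatest) (simp add: ba_sym_diff_le_iff)
    moreover have "- b m = sup (inf (- b m) l) (inf (- b m) (- l))"
      by (simp flip: inf_sup_distrib1)
    ultimately show "- b m \<le> decided_on a (r ` {m..})"
      unfolding decided_on_image unfolding decided_on_def comp_def by (metis sup_mono)
  qed
  then have "(SUP m. - b m) \<le> (SUP Y\<in>{Y. infinite Y}. decided_on a Y)"
    by (rule SUP_least)
  moreover have "(SUP m. - b m) = top"
    using b(2) by (simp flip: compl_INF)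
  ultimately show ?thesis
    by (simp add: top_unique)
qed

lemma alg_converges_if_eventually_decided:
  fixes a :: "nat \<Rightarrow> 'b::{boolean_algebra, complete_lattice}"
  assumes Z: "infinite Z" and top: "eventually_decided_on a Z = top"
  shows "\<exists>l. alg_converges (a \<circ> enumerate Z) l"
proof -
  \<comment> \<open>Below \<open>p m\<close> the tail of \<open>Z\<close> from \<open>m\<close> is
    constantly true, below \<open>q m\<close> constantly false; \<open>b\<close> collects what is
    still undecided. The limit will be the join of all \<open>p m\<close>.\<close>
  define p where "p m = (INF n\<in>Z \<inter> {m..}. a n)" for m
  define q where "q m = (INF n\<in>Z \<inter> {m..}. - a n)" for m
  define b where "b m = - sup (p (enumerate Z m)) (q (enumerate Z m))" for m
  have mono: "p m \<le> p n" "q m \<le> q n" if "m \<le> n" for m n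
    using that unfolding p_def q_def by (auto intro!: INF_superset_mono)
  have pq: "p m \<le> - q n" for m n
  proof -
    \<comment> \<open>An index in both tails: its term is true below \<open>p m\<close> and false
      below \<open>q n\<close>.\<close>
    obtain k where k: "k \<in> Z" "k \<ge> max m n"
      using Z by (meson infinite_nat_iff_unbounded_le)
    have "p m \<le> a k"
      unfolding p_def by (rule INF_lower) (use k in simp)
    also have "q n \<le> - a k"
      unfolding q_def by (rule INF_lower) (use k in simp)
    then have "a k \<le> - q n"
      by (rule compl_le_swap1)
    finally show ?thesis .
  qed
  have le: "p m \<le> a m" "q m \<le> - a m" if "m \<in> Z" for m
    using that unfolding p_def q_def by (auto intro: INF_lower)
  have "decseq b"
    unfolding b_def
    by (intro decseq_SucI compl_mono sup_mono mono less_imp_le[OF enumerate_step[OF Z]])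
  moreover have "(INF n. b n) = bot"
  proof -
    \<comment> \<open>Reindexing along \<open>Z\<close> loses nothing, because
      \<open>n \<le> enumerate Z n\<close>.\<close>
    have "eventually_decided_on a Z \<le> (SUP n. sup (p (enumerate Z n)) (q (enumerate Z n)))"
      unfolding eventually_decided_on_def decided_on_def p_def[symmetric] q_def[symmetric]
      by (intro SUP_mono' sup_mono mono le_enumerate Z)
    then have "(SUP n. sup (p (enumerate Z n)) (q (enumerate Z n))) = top"
      unfolding top by (rule top_le)
    then show ?thesis
      unfolding b_def compl_SUP[symmetric] by simp
  qed
  moreover have "ba_sym_diff (a (enumerate Z n)) (SUP m. p m) \<le> b n" for n
  proof -
    \<comment> \<open>On \<open>p ?e\<close> both the term and the limit are true, on
      \<open>q ?e\<close> both are false; so they differ only inside \<open>b n\<close>.\<close>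
    let ?e = "enumerate Z n"
    have "q ?e \<le> - (SUP m. p m)"
      unfolding compl_SUP by (rule INF_greatest) (rule pq[THEN compl_le_swap1])
    then have "(SUP m. p m) \<le> - q ?e"
      by (rule compl_le_swap1)
    moreover have "- (SUP m. p m) \<le> - p ?e"
      by (intro compl_mono SUP_upper UNIV_I)
    moreover have "- a ?e \<le> - p ?e" "a ?e \<le> - q ?e"
      using le[OF enumerate_in_set[OF Z, of n]] by (simp, metis compl_le_swap1)
    ultimately show ?thesis
      unfolding b_def ba_sym_diff_def diff_eq compl_sup
      by (intro sup_least inf_greatest) (blast intro: le_infI1 le_infI2)+
  qed
  ultimately show ?thesis
    unfolding alg_converges_def alg_null_def by auto
qed


section \<open>Exhaustion\<close>

text \<open>Finitely many members always have an almost least one, so their intersection is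
  infinite; a strictly increasing diagonal choice from these intersections gives
  \<open>P\<close>.\<close>

lemma countable_almost_chain_pseudo_inter:
  fixes K :: "nat set set"
  assumes K: "countable K" "\<And>Z. Z \<in> K \<Longrightarrow> infinite Z"
    and chain: "\<And>Y Z. Y \<in> K \<Longrightarrow> Z \<in> K \<Longrightarrow> finite (Y - Z) \<or> finite (Z - Y)"
  obtains P where "infinite P" "\<And>Z. Z \<in> K \<Longrightarrow> finite (P - Z)"
proof (cases "K = {}")
  case True
  then show ?thesis
    using that[of UNIV] by simp
next
  case False
  define Z where "Z = from_nat_into K"
  have ZK: "Z i \<in> K" for i
    unfolding Z_def using False by (rule from_nat_into)
  have least: "\<exists>j\<le>n. \<forall>i\<le>n. finite (Z j - Z i)" for n
  proof (induction n)
    case 0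
    then show ?case by simp
  next
    case (Suc n)
    then obtain j where j: "j \<le> n" "\<forall>i\<le>n. finite (Z j - Z i)"
      by blast
    show ?case
    proof (cases "finite (Z j - Z (Suc n))")
      case True
      then show ?thesis
        using j by (intro exI[of _ j]) (auto simp: le_Suc_eq)
    next
      case False
      then have fin: "finite (Z (Suc n) - Z j)"
        using chain[OF ZK ZK] by blast
      have "finite (Z (Suc n) - Z i)" if "i \<le> n" for i
        by (rule finite_subset[of _ "(Z (Suc n) - Z j) \<union> (Z j - Z i)"]) (use fin j(2) that in auto)
      then show ?thesis
        by (intro exI[of _ "Suc n"]) (auto simp: le_Suc_eq)
    qed
  qed
  have inf: "infinite (\<Inter>i\<le>n. Z i)" for n
  proof
    assume fin: "finite (\<Inter>i\<le>n. Z i)"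
    obtain j where j: "j \<le> n" "\<forall>i\<le>n. finite (Z j - Z i)"
      using least by blast
    have "Z j \<subseteq> (\<Inter>i\<le>n. Z i) \<union> (\<Union>i\<le>n. Z j - Z i)"
      by blast
    then have "finite (Z j)"
      by (rule finite_subset) (use fin j(2) in \<open>intro finite_UnI finite_UN_I; simp\<close>)
    then show False
      using K(2) ZK by blast
  qed
  have "\<exists>p. \<forall>n. p n \<in> (\<Inter>i\<le>n. Z i) \<and> p n < p (Suc n)"
  proof (rule dependent_nat_choice)
    show "\<exists>x. x \<in> (\<Inter>i\<le>0. Z i)"
      using inf[of 0] by (metis finite.emptyI ex_in_conv)
    show "\<exists>y. y \<in> (\<Inter>i\<le>Suc n. Z i) \<and> x < y" for x n
      using inf[of "Suc n"] unfolding infinite_nat_iff_unbounded by blast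
  qed
  then obtain p where p: "\<And>n. p n \<in> (\<Inter>i\<le>n. Z i)" "\<And>n. p n < p (Suc n)"
    by blast
  have "strict_mono p"
    using p(2) by (simp add: strict_mono_Suc_iff)
  then have "infinite (range p)"
    by (simp add: range_inj_infinite strict_mono_imp_inj_on)
  moreover have "finite (range p - Y)" if Y: "Y \<in> K" for Y
  proof -
    obtain i where i: "Y = Z i"
      unfolding Z_def using from_nat_into_surj[OF K(1) Y] by metis
    \<comment> \<open>From index \<open>i\<close> on, \<open>p\<close> stays inside
      \<open>Z i\<close>.\<close>
    have "range p - Y \<subseteq> p ` {..<i}"
      using p(1) unfolding i by (force simp: not_less[symmetric])
    then show ?thesis
      by (rule finite_subset) simp
  qed
  ultimately show ?thesis
    by (rule that)
qed

text \<open>Density is applied to the reindexed sequence \<open>a \<circ> e\<close>, not to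
  \<open>a\<close>, so that \<open>e\<close> carries the deciding set back into
  \<open>Z\<close>.\<close>

lemma ex_eventually_decided_strictly_more:
  fixes a :: "nat \<Rightarrow> 'b::{boolean_algebra, complete_lattice}"
  assumes dense: "\<And>x::nat \<Rightarrow> 'b. (SUP Y\<in>{Y. infinite Y}. decided_on x Y) = top"
    and Z: "infinite Z" "eventually_decided_on a Z \<noteq> top"
  obtains Y where "infinite Y" "Y \<subseteq> Z" "eventually_decided_on a Z < eventually_decided_on a Y"
proof -
  define e where "e = enumerate Z"
  have "\<exists>Y. infinite Y \<and> \<not> decided_on (a \<circ> e) Y \<le> eventually_decided_on a Z"
  proof (rule ccontr)
    assume "\<not> ?thesis"
    then have "(SUP Y\<in>{Y. infinite Y}. decided_on (a \<circ> e) Y) \<le> eventually_decided_on a Z"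
      by (intro SUP_least) blast
    then show False
      using dense[of "a \<circ> e"] Z(2) by (simp add: top_unique)
  qed
  then obtain Y where Y: "infinite Y" "\<not> decided_on (a \<circ> e) Y \<le> eventually_decided_on a Z"
    by blast
  have sub: "e ` Y \<subseteq> Z"
    unfolding e_def using enumerate_in_set[OF Z(1)] by blast
  have "inj_on e Y"
    unfolding e_def using strict_mono_enumerate[OF Z(1)]
    by (metis inj_on_subset strict_mono_imp_inj_on subset_UNIV)
  then have "infinite (e ` Y)"
    using Y(1) by (simp add: finite_image_iff)
  moreover have "\<not> eventually_decided_on a (e ` Y) \<le> eventually_decided_on a Z"
    using Y(2) decided_on_le_eventually[of a "e ` Y"] unfolding decided_on_image
    by (meson order_trans)
  moreover have "eventually_decided_on a Z \<le> eventually_decided_on a (e ` Y)"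
    using sub by (intro eventually_decided_on_mono) (metis Diff_eq_empty_iff finite.emptyI)
  ultimately show ?thesis
    using that sub by (simp add: less_le_not_le)
qed

lemma ex_eventually_decided_top:
  fixes a :: "nat \<Rightarrow> 'b::{boolean_algebra, complete_lattice}"
  assumes ccc: "ccc TYPE('b)"
    and dense: "\<And>x::nat \<Rightarrow> 'b. (SUP Y\<in>{Y. infinite Y}. decided_on x Y) = top"
  obtains Z where "infinite Z" "eventually_decided_on a Z = top"
proof -
  let ?c = "eventually_decided_on a"
  define I where "I = {Z::nat set. infinite Z}"
  \<comment> \<open>Almost inclusion alone is only a preorder; demanding strict growth of
    \<open>?c\<close> makes the relation antisymmetric.\<close>
  define R where "R Y Z \<longleftrightarrow> Y = Z \<or> finite (Z - Y) \<and> ?c Y < ?c Z" for Y Z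
  have "\<exists>M\<in>I. \<forall>Z\<in>I. R M Z \<longrightarrow> Z = M"
  proof (rule predicate_Zorn)
    show "partial_order_on I (relation_of R I)"
    proof (rule partial_order_on_relation_ofI)
      fix X Y Z assume XYZ: "R X Y" "R Y Z"
      have "finite (Z - X)" if "finite (Z - Y)" "finite (Y - X)"
        by (rule finite_subset[of _ "(Z - Y) \<union> (Y - X)"]) (use that in auto)
      then show "R X Z"
        using XYZ unfolding R_def by (metis order.strict_trans)
    qed (auto simp: R_def)
  next
    fix K assume K: "K \<in> Chains (relation_of R I)"
    have KI: "Z \<in> I" if "Z \<in> K" for Z
      using K that unfolding Chains_def relation_of_def by blast
    have total: "R Y Z \<or> R Z Y" if "Y \<in> K" "Z \<in> K" for Y Z
      using K that unfolding Chains_def relation_of_def by blast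
    have R_le: "?c Y \<le> ?c Z" if "R Y Z" for Y Z
      using that unfolding R_def by auto
    show "\<exists>U\<in>I. \<forall>Z\<in>K. R Z U"
    proof (cases "\<exists>U\<in>K. \<forall>Z\<in>K. R Z U")
      case True
      then show ?thesis
        using KI by blast
    next
      case False
      \<comment> \<open>Without a greatest member, every member of the chain has one of strictly
        larger value. By ccc, countably many values have the same join as all.\<close>
      obtain E where E: "countable E" "E \<subseteq> ?c ` K" "Sup E = Sup (?c ` K)"
        by (rule ccc_countable_Sup[OF ccc])
      then obtain L where L: "countable L" "L \<subseteq> K" "?c ` L = E"
        by (metis countable_subset_image)
      \<comment> \<open>Otherwise \<open>?c Z\<close> would bound the values on \<open>L\<close>,
        hence on all of \<open>K\<close>, although some \<open>W\<close> in \<open>K\<close> exceeds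
        it.\<close>
      have cofinal: "\<exists>Y\<in>L. R Z Y" if Z: "Z \<in> K" for Z
      proof (rule ccontr)
        assume "\<not> ?thesis"
        then have "?c Y \<le> ?c Z" if "Y \<in> L" for Y
          using total R_le L(2) Z that by blast
        then have "Sup (?c ` K) \<le> ?c Z"
          unfolding E(3)[symmetric] L(3)[symmetric] by (rule SUP_least)
        moreover obtain W where W: "W \<in> K" "\<not> R W Z"
          using False Z by blast
        then have "?c Z < ?c W"
          using total[OF W(1) Z] unfolding R_def by auto
        ultimately show False
          using SUP_upper[OF W(1), of ?c] by (metis order.trans leD)
      qed
      obtain P where P: "infinite P" "\<And>Y. Y \<in> L \<Longrightarrow> finite (P - Y)"
      proof (rule countable_almost_chain_pseudo_inter[OF L(1)])
        show "infinite Z" if "Z \<in> L" for Z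
          using KI L(2) that unfolding I_def by blast
        show "finite (Y - Z) \<or> finite (Z - Y)" if "Y \<in> L" "Z \<in> L" for Y Z
        proof -
          have "R Y Z \<or> R Z Y"
            using total L(2) that by blast
          then show ?thesis
            unfolding R_def by auto
        qed
      qed blast
      \<comment> \<open>Passing through a strictly larger \<open>W\<close> and some \<open>Y\<close>
        in \<open>L\<close> above it gives the strict inequality that \<open>R\<close>
        demands.\<close>
      have "R Z P" if Z: "Z \<in> K" for Z
      proof -
        obtain W where W: "W \<in> K" "\<not> R W Z"
          using False Z by blast
        then have less: "?c Z < ?c W"
          using total[OF W(1) Z] unfolding R_def by auto
        obtain Y where Y: "Y \<in> L" "R W Y"
          using cofinal[OF W(1)] by blast
        have "?c Y \<le> ?c P"
          using P(2)[OF Y(1)] by (rule eventually_decided_on_mono)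
        then have "?c Z < ?c P"
          using less R_le[OF Y(2)] by (meson order.strict_trans1 order.strict_trans2)
        moreover obtain V where V: "V \<in> L" "R Z V"
          using cofinal[OF Z] by blast
        have "finite (P - Z)"
          by (rule finite_subset[of _ "(P - V) \<union> (V - Z)"])
            (use P(2)[OF V(1)] V(2) in \<open>auto simp: R_def\<close>)
        ultimately show ?thesis
          unfolding R_def by blast
      qed
      then show ?thesis
        using P(1) unfolding I_def by blast
    qed
  qed
  then obtain M where M: "infinite M" "\<And>Z. infinite Z \<Longrightarrow> R M Z \<Longrightarrow> Z = M"
    unfolding I_def by blast
  have "?c M = top"
  proof (rule ccontr)
    assume "?c M \<noteq> top"
    from ex_eventually_decided_strictly_more[OF dense M(1) this]
    obtain Y where Y: "infinite Y" "Y \<subseteq> M" "?c M < ?c Y" .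
    have "R M Y"
      using Y(2,3) unfolding R_def by (metis Diff_eq_empty_iff finite.emptyI)
    then show False
      using M(2)[OF Y(1)] Y(3) by simp
  qed
  then show ?thesis
    using that M(1) by blast
qed

theorem mainTheorem3:
  assumes "ccc TYPE('b::{boolean_algebra, complete_lattice})"
  shows "\<not> adds_independent_real TYPE('i) TYPE('b) \<longleftrightarrow>
           seq_compact_space (order_seq_topology :: 'b topology)"
  unfolding adds_independent_real_iff seq_compact_order_seq_iff
proof (intro iffI allI)
  fix x :: "nat \<Rightarrow> 'b"
  assume "\<not> (\<exists>a::nat \<Rightarrow> 'b. (SUP Y\<in>{Y. infinite Y}. decided_on a Y) \<noteq> top)"
  then have "(SUP Y\<in>{Y. infinite Y}. decided_on a Y) = top" for a :: "nat \<Rightarrow> 'b"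
    by blast
  \<comment> \<open>Here ccc enters, through the exhaustion; enumerating \<open>Z\<close> gives the
    subsequence.\<close>
  from ex_eventually_decided_top[OF assms this, of x]
  obtain Z where Z: "infinite Z" "eventually_decided_on x Z = top" .
  then show "\<exists>l r. strict_mono r \<and> alg_converges (x \<circ> r) l"
    using alg_converges_if_eventually_decided strict_mono_enumerate by blast
next
  assume "\<forall>x::nat \<Rightarrow> 'b. \<exists>l r. strict_mono r \<and> alg_converges (x \<circ> r) l"
  then show "\<not> (\<exists>a::nat \<Rightarrow> 'b. (SUP Y\<in>{Y. infinite Y}. decided_on a Y) \<noteq> top)"
    using SUP_decided_on_if_alg_converges by blast
qed

end
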